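(* Let $X$ be a weakly sequentially complete Banach space and let $\mathcal{F}=\{(x_n,f_n)\}_{n\ge 1}\subset X\times X^*$. Then $\mathcal{F}$ is an unconditional Schauder frame of $X$ if and only if $\mathcal{F}$ is a besselian Schauder frame of $X$.
   Context: Banach spaces are over $\mathbb{K}\in\{\mathbb{R},\mathbb{C}\}$; $X^*$ denotes the topological dual of $X$. $X$ is weakly sequentially complete if for each sequence $(y_n)$ in $X$ such that $\lim_n f(y_n)$ exists for every $f\in X^*$, there is $y\in X$ with $\lim_n f(y_n)=f(y)$ for all $f\in X^*$. $\mathcal{F}$ is a Schauder frame (resp. unconditional Schauder frame) of $X$ if for every $x\in X$ the series $\sum_n f_n(x)x_n$ converges (resp. converges unconditionally) in $X$ to $x$. $\mathcal{F}$ is besselian if there is a constant $C>0$ with $\sum_{n=1}^{\infty}|f_n(x)|\,|f(x_n)|\le C\|x\|_X\|f\|_{X^*}$ for all $x\in X$, $f\in X^*$; a besselian Schauder frame is a Schauder frame that is besselian. *)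

theory Defs
  imports "HOL-Analysis.Analysis"
begin

text \<open>The scalar fields: normed fields that are, up to isometric isomorphism over the reals,
  \<open>\<real>\<close> or \<open>\<complex>\<close>.\<close>

class real_or_complex = real_normed_field +
  assumes ex_real_or_complex_iso:
    "\<exists>\<phi> :: 'a \<Rightarrow> complex.
       (range \<phi> = \<real> \<or> range \<phi> = UNIV) \<and>
       (\<forall>z w. \<phi> (z + w) = \<phi> z + \<phi> w) \<and>
       (\<forall>z w. \<phi> (z * w) = \<phi> z * \<phi> w) \<and>
       (\<forall>r z. \<phi> (r *\<^sub>R z) = r *\<^sub>R \<phi> z) \<and>
       (\<forall>z. norm (\<phi> z) = norm z)"

instance real :: real_or_complex
  by standard (rule exI[of _ complex_of_real], simp add: Reals_def scaleR_conv_of_real)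

instance complex :: real_or_complex
  by standard (rule exI[of _ "\<lambda>z. z"], simp)

text \<open>The class \<open>banach\<close> only knows real scalars. A Banach space over \<open>'k\<close> is a type of that class
  with a compatible scalar multiplication by \<open>'k\<close>; for \<open>'k = real\<close> this forces
  \<open>scaleK = scaleR\<close>.\<close>

locale banach_space_over = vector_space scaleK
  for scaleK :: "'k::real_or_complex \<Rightarrow> 'a::banach \<Rightarrow> 'a" +
  assumes scale_of_real: "scaleK (of_real r) x = r *\<^sub>R x"
    and norm_scale: "norm (scaleK c x) = norm c * norm x"

text \<open>Elements of \<open>'a \<Rightarrow>\<^sub>L 'k\<close> are bounded and real-linear; the dual requires
  linearity over \<open>'k\<close>. The norm of \<open>'a \<Rightarrow>\<^sub>L 'k\<close> is the operator norm.\<close>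

definition topological_dual ::
    "('k::real_or_complex \<Rightarrow> 'a::banach \<Rightarrow> 'a) \<Rightarrow> ('a \<Rightarrow>\<^sub>L 'k) set"
  where "topological_dual scaleK = {g. \<forall>c x. blinfun_apply g (scaleK c x) = c * blinfun_apply g x}"

definition weakly_sequentially_complete ::
    "('k::real_or_complex \<Rightarrow> 'a::banach \<Rightarrow> 'a) \<Rightarrow> bool"
  where "weakly_sequentially_complete scaleK \<longleftrightarrow>
    (\<forall>y :: nat \<Rightarrow> 'a.
       (\<forall>g \<in> topological_dual scaleK. convergent (\<lambda>n. blinfun_apply g (y n))) \<longrightarrow>
       (\<exists>z. \<forall>g \<in> topological_dual scaleK.
          (\<lambda>n. blinfun_apply g (y n)) \<longlonglongrightarrow> blinfun_apply g z))"

definition unconditionally_sums :: "(nat \<Rightarrow> 'a::real_normed_vector) \<Rightarrow> 'a \<Rightarrow> bool"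
  where "unconditionally_sums a s \<longleftrightarrow>
    a sums s \<and> (\<forall>\<pi>. bij \<pi> \<longrightarrow> summable (\<lambda>n. a (\<pi> n)))"

definition schauder_frame ::
    "('k::real_or_complex \<Rightarrow> 'a::banach \<Rightarrow> 'a) \<Rightarrow> (nat \<Rightarrow> 'a) \<Rightarrow> (nat \<Rightarrow> 'a \<Rightarrow>\<^sub>L 'k) \<Rightarrow> bool"
  where "schauder_frame scaleK x f \<longleftrightarrow>
    (\<forall>v. (\<lambda>n. scaleK (blinfun_apply (f n) v) (x n)) sums v)"

definition unconditional_schauder_frame ::
    "('k::real_or_complex \<Rightarrow> 'a::banach \<Rightarrow> 'a) \<Rightarrow> (nat \<Rightarrow> 'a) \<Rightarrow> (nat \<Rightarrow> 'a \<Rightarrow>\<^sub>L 'k) \<Rightarrow> bool"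
  where "unconditional_schauder_frame scaleK x f \<longleftrightarrow>
    (\<forall>v. unconditionally_sums (\<lambda>n. scaleK (blinfun_apply (f n) v) (x n)) v)"

text \<open>Summability is required explicitly, since \<open>suminf\<close> of a divergent series is unspecified.\<close>

definition besselian ::
    "('k::real_or_complex \<Rightarrow> 'a::banach \<Rightarrow> 'a) \<Rightarrow> (nat \<Rightarrow> 'a) \<Rightarrow> (nat \<Rightarrow> 'a \<Rightarrow>\<^sub>L 'k) \<Rightarrow> bool"
  where "besselian scaleK x f \<longleftrightarrow>
    (\<exists>C>0. \<forall>v. \<forall>g \<in> topological_dual scaleK.
       summable (\<lambda>n. norm (blinfun_apply (f n) v) * norm (blinfun_apply g (x n))) \<and>
       (\<Sum>n. norm (blinfun_apply (f n) v) * norm (blinfun_apply g (x n))) \<le> C * norm v * norm g)"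

definition besselian_schauder_frame ::
    "('k::real_or_complex \<Rightarrow> 'a::banach \<Rightarrow> 'a) \<Rightarrow> (nat \<Rightarrow> 'a) \<Rightarrow> (nat \<Rightarrow> 'a \<Rightarrow>\<^sub>L 'k) \<Rightarrow> bool"
  where "besselian_schauder_frame scaleK x f \<longleftrightarrow>
    schauder_frame scaleK x f \<and> besselian scaleK x f"

end

theory Submission
  imports Defs
begin

text \<open>For a series in a Banach space, summability of all rearrangements is the same as smallness of
  all finite sums far out, and this is the form of unconditional convergence used on both sides.

  From unconditional to besselian: for fixed \<open>v\<close> the finite sums of \<open>f\<^sub>n(v) x\<^sub>n\<close> are bounded, so
  uniform boundedness gives a constant \<open>M\<close> with \<open>\<parallel>\<Sum>\<^sub>n\<^sub>\<in>\<^sub>A f\<^sub>n(v) x\<^sub>n\<parallel> \<le> M \<parallel>v\<parallel>\<close> for all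
  finite \<open>A\<close>. Applying \<open>g\<close> bounds every subset sum of the scalars \<open>f\<^sub>n(v) g(x\<^sub>n)\<close> by
  \<open>M \<parallel>v\<parallel> \<parallel>g\<parallel>\<close>, hence the sum of their absolute values by four times that.

  From besselian to unconditional: fix \<open>v\<close> and put \<open>a\<^sub>n = f\<^sub>n(v) x\<^sub>n\<close>. Since \<open>\<Sum> |g(a\<^sub>n)|\<close>
  converges for every \<open>g\<close> in the dual, weak sequential completeness gives every subseries a weak
  sum; write \<open>z(A)\<close> for the weak sum over \<open>n \<in> A\<close>. The coefficients \<open>f\<^sub>m(z(A))\<close> depend
  continuously on \<open>A\<close> in the Cantor space of all sets of indices, and the frame expansion writes
  \<open>z\<close> as a pointwise limit, in norm, of the continuous maps \<open>A \<mapsto> \<Sum>\<^sub>m\<^sub><\<^sub>N f\<^sub>m(z(A)) x\<^sub>m\<close>. By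
  the Baire category theorem \<open>z\<close> has oscillation less than \<open>e\<close> on some cylinder, that is, on
  all sets that agree with one set \<open>A\<close> below some \<open>K\<close>. For a finite set \<open>F\<close> of indices
  \<open>\<ge> K\<close> the sets \<open>A \<union> F\<close> and \<open>A - F\<close> lie in that cylinder, and the difference of their
  values is \<open>\<Sum>\<^sub>n\<^sub>\<in>\<^sub>F a\<^sub>n\<close>; so this sum has norm less than \<open>e\<close>. The frame expansion replaces
  the Hahn-Banach theorem of the usual argument through the Orlicz-Pettis theorem: the coefficient
  functionals \<open>f\<^sub>m\<close> already separate points.\<close>

section \<open>Scalars\<close>

text \<open>The isometry embeds the field onto a closed subset of \<open>\<complex>\<close>, so completeness is inherited. It is
  what makes absolutely convergent scalar series converge.\<close>

instance real_or_complex \<subseteq> banach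
proof
  fix X :: "nat \<Rightarrow> 'a::real_or_complex"
  assume X: "Cauchy X"
  obtain \<phi> :: "'a \<Rightarrow> complex" where ran: "range \<phi> = \<real> \<or> range \<phi> = UNIV"
    and add: "\<And>z w. \<phi> (z + w) = \<phi> z + \<phi> w" and norm: "\<And>z. norm (\<phi> z) = norm z"
    using ex_real_or_complex_iso by metis
  have iso: "dist (\<phi> z) (\<phi> w) = dist z w" for z w
    using add[of "z - w" w] norm[of "z - w"] by (simp add: dist_norm)
  have "Cauchy (\<lambda>n. \<phi> (X n))"
    using X by (simp add: Cauchy_def iso)
  then obtain l where l: "(\<lambda>n. \<phi> (X n)) \<longlonglongrightarrow> l"
    using Cauchy_convergent convergent_def by blast
  moreover have "closed (range \<phi>)"
    using ran closed_complex_Reals by auto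
  ultimately have "l \<in> range \<phi>"
    using closed_sequentially[of "range \<phi>" "\<lambda>n. \<phi> (X n)" l] by simp
  then obtain x where "l = \<phi> x" by blast
  with l have "X \<longlonglongrightarrow> x"
    by (simp add: tendsto_iff iso)
  then show "convergent X"
    by (auto simp: convergent_def)
qed

text \<open>The indices split according to the signs of the real part and of the imaginary part; on each of
  the four resulting sets the absolute values add up without cancellation.\<close>

lemma sum_norm_le_4_subset_sums_complex:
  fixes c :: "'i \<Rightarrow> complex"
  assumes "finite A" and M: "\<And>B. B \<subseteq> A \<Longrightarrow> norm (\<Sum>n\<in>B. c n) \<le> M"
  shows "(\<Sum>n\<in>A. norm (c n)) \<le> 4 * M"
proof -
  have real: "(\<Sum>n\<in>A. \<bar>r n\<bar>) \<le> 2 * M"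
    if r: "\<And>B. B \<subseteq> A \<Longrightarrow> \<bar>\<Sum>n\<in>B. r n\<bar> \<le> M" for r :: "'i \<Rightarrow> real"
  proof -
    define P where "P = {n\<in>A. 0 \<le> r n}"
    have "(\<Sum>n\<in>A. \<bar>r n\<bar>) = (\<Sum>n\<in>P. \<bar>r n\<bar>) + (\<Sum>n\<in>A - P. \<bar>r n\<bar>)"
      using \<open>finite A\<close> by (subst sum.subset_diff[of P]) (auto simp: P_def)
    also have "\<dots> = (\<Sum>n\<in>P. r n) - (\<Sum>n\<in>A - P. r n)"
      unfolding sum_negf[symmetric] diff_conv_add_uminus
      by (intro arg_cong2[where f = "(+)"] sum.cong) (auto simp: P_def)
    also have "\<dots> \<le> 2 * M"
      using r[of P] r[of "A - P"] by (auto simp: P_def)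
    finally show ?thesis .
  qed
  have "\<bar>\<Sum>n\<in>B. Re (c n)\<bar> \<le> M" "\<bar>\<Sum>n\<in>B. Im (c n)\<bar> \<le> M" if "B \<subseteq> A" for B
    using M[OF that] abs_Re_le_cmod[of "\<Sum>n\<in>B. c n"] abs_Im_le_cmod[of "\<Sum>n\<in>B. c n"] by auto
  then have "(\<Sum>n\<in>A. \<bar>Re (c n)\<bar>) + (\<Sum>n\<in>A. \<bar>Im (c n)\<bar>) \<le> 4 * M"
    using real[of "\<lambda>n. Re (c n)"] real[of "\<lambda>n. Im (c n)"] by fastforce
  moreover have "(\<Sum>n\<in>A. norm (c n)) \<le> (\<Sum>n\<in>A. \<bar>Re (c n)\<bar> + \<bar>Im (c n)\<bar>)"
    by (intro sum_mono cmod_le)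
  ultimately show ?thesis
    by (simp add: sum.distrib)
qed

lemma sum_norm_le_4_subset_sums:
  fixes c :: "'i \<Rightarrow> 'k::real_or_complex"
  assumes "finite A" and M: "\<And>B. B \<subseteq> A \<Longrightarrow> norm (\<Sum>n\<in>B. c n) \<le> M"
  shows "(\<Sum>n\<in>A. norm (c n)) \<le> 4 * M"
proof -
  obtain \<phi> :: "'k \<Rightarrow> complex" where add: "\<And>z w. \<phi> (z + w) = \<phi> z + \<phi> w"
    and norm: "\<And>z. norm (\<phi> z) = norm z"
    using ex_real_or_complex_iso by metis
  have \<phi>_sum: "\<phi> (\<Sum>n\<in>B. c n) = (\<Sum>n\<in>B. \<phi> (c n))" for B
    using norm[of 0] by (induction B rule: infinite_finite_induct) (auto simp: add)
  show ?thesis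
    using sum_norm_le_4_subset_sums_complex[OF \<open>finite A\<close>, of "\<lambda>n. \<phi> (c n)" M] M
    by (simp add: norm flip: \<phi>_sum)
qed

section \<open>Unconditional convergence\<close>

text \<open>The Cauchy condition for the net of finite partial sums.\<close>

definition unconditionally_Cauchy :: "(nat \<Rightarrow> 'a::real_normed_vector) \<Rightarrow> bool"
  where "unconditionally_Cauchy a \<longleftrightarrow>
    (\<forall>e>0. \<exists>N. \<forall>F. finite F \<longrightarrow> F \<subseteq> {N..} \<longrightarrow> norm (\<Sum>n\<in>F. a n) < e)"

text \<open>The intervals \<open>[N k, N (k + 1))\<close> partition the natural numbers, so permutations of the
  single blocks form together one permutation.\<close>

lemma bij_betw_glue_blocks:
  fixes N :: "nat \<Rightarrow> nat"
  assumes "strict_mono N" "N 0 = 0"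
    and p: "\<And>k. bij_betw (p k) {N k..<N (Suc k)} {N k..<N (Suc k)}"
  obtains \<pi> where "bij \<pi>" "\<And>k n. n \<in> {N k..<N (Suc k)} \<Longrightarrow> \<pi> n = p k n"
proof
  define block where "block n = (LEAST k. n < N (Suc k))" for n
  define \<pi> where "\<pi> n = p (block n) n" for n
  have mono: "N i \<le> N j" if "i \<le> j" for i j
    using \<open>strict_mono N\<close> that by (simp add: strict_mono_less_eq)
  have block: "block n = k" if "n \<in> {N k..<N (Suc k)}" for n k
    unfolding block_def
  proof (rule Least_equality)
    fix j assume "n < N (Suc j)"
    then show "k \<le> j"
      using that mono[of "Suc j" k] by (force simp: not_less_eq_eq)
  qed (use that in auto)
  show \<pi>: "\<pi> n = p k n" if "n \<in> {N k..<N (Suc k)}" for n k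
    using block[OF that] by (simp add: \<pi>_def)
  have cover: "(\<Union>k. {N k..<N (Suc k)}) = UNIV"
  proof -
    have "\<exists>k. n \<in> {N k..<N (Suc k)}" for n
    proof (induction n)
      case 0
      show ?case
        using \<open>N 0 = 0\<close> strict_monoD[OF \<open>strict_mono N\<close>, of 0 1] by (intro exI[of _ 0]) auto
    next
      case (Suc n)
      then obtain k where k: "n \<in> {N k..<N (Suc k)}" by blast
      show ?case
      proof (cases "Suc n < N (Suc k)")
        case True
        then show ?thesis using k by (intro exI[of _ k]) auto
      next
        case False
        then have "Suc n = N (Suc k)" using k by auto
        then show ?thesis
          using strict_monoD[OF \<open>strict_mono N\<close>, of "Suc k" "Suc (Suc k)"]
          by (intro exI[of _ "Suc k"]) auto
      qed
    qed
    then show ?thesis by blast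
  qed
  have "disjoint_family (\<lambda>k. {N k..<N (Suc k)})"
    unfolding disjoint_family_on_def using block by blast
  moreover have "bij_betw \<pi> {N k..<N (Suc k)} {N k..<N (Suc k)}" for k
    using p[of k] bij_betw_cong[of "{N k..<N (Suc k)}" \<pi> "p k"] \<pi> by auto
  ultimately have "bij_betw \<pi> (\<Union>k. {N k..<N (Suc k)}) (\<Union>k. {N k..<N (Suc k)})"
    by (intro bij_betw_UNION_disjoint) auto
  then show "bij \<pi>"
    by (simp add: cover)
qed

text \<open>If the Cauchy condition fails, there are finite sets \<open>F k\<close>, in consecutive blocks, whose sums
  have norm at least \<open>e\<close>. The rearrangement that lists \<open>F k\<close> first within its block has these
  sums as sums over intervals of indices, so its partial sums are not Cauchy.\<close>

lemma unconditionally_Cauchy_if_rearrangements_summable: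
  fixes a :: "nat \<Rightarrow> 'a::real_normed_vector"
  assumes "\<And>\<pi>. bij \<pi> \<Longrightarrow> summable (\<lambda>n. a (\<pi> n))"
  shows "unconditionally_Cauchy a"
proof (rule ccontr)
  assume "\<not> unconditionally_Cauchy a"
  then obtain e where "e > 0"
    and "\<And>N. \<exists>F. finite F \<and> F \<subseteq> {N..} \<and> e \<le> norm (\<Sum>n\<in>F. a n)"
    unfolding unconditionally_Cauchy_def by (meson not_less)
  then obtain G where G: "\<And>N. finite (G N)" "\<And>N. G N \<subseteq> {N..}"
    "\<And>N. e \<le> norm (\<Sum>n\<in>G N. a n)"
    by metis
  \<comment> \<open>One more than the maximum, so that \<open>F k\<close> ends inside its block; inserting the start makes \<open>N\<close> strictly increasing.\<close>
  define next_start where "next_start N = Suc (Max (insert N (G N)))" for N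
  define N where "N = rec_nat 0 (\<lambda>_. next_start)"
  define F where "F k = G (N k)" for k
  have N_0: "N 0 = 0" and N_Suc: "N (Suc k) = next_start (N k)" for k
    by (simp_all add: N_def)
  have N_less: "N k < N (Suc k)" for k
    using G(1) by (simp add: N_Suc next_start_def less_Suc_eq_le)
  then have "strict_mono N"
    by (simp add: strict_mono_Suc_iff)
  have F: "F k \<subseteq> {N k..<N (Suc k)}" for k
  proof
    fix n assume "n \<in> F k"
    moreover from this have "n \<le> Max (insert (N k) (G (N k)))"
      using G(1) by (intro Max_ge) (auto simp: F_def)
    ultimately show "n \<in> {N k..<N (Suc k)}"
      using G(2)[of "N k"] by (auto simp: F_def N_Suc next_start_def less_Suc_eq_le)
  qed
  have fin: "finite (F k)" for k
    by (simp add: F_def G)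
  have card_F: "N k + card (F k) \<le> N (Suc k)" for k
    using card_mono[OF _ F[of k]] N_less[of k] by simp
  have "\<exists>p. bij_betw p {N k..<N (Suc k)} {N k..<N (Suc k)} \<and> p ` {N k..<N k + card (F k)} = F k" for k
  proof -
    let ?I = "{N k..<N k + card (F k)}" and ?J = "{N k + card (F k)..<N (Suc k)}"
      and ?B = "{N k..<N (Suc k)}"
    obtain h1 where h1: "bij_betw h1 ?I (F k)"
      using finite_same_card_bij[of ?I "F k"] fin by auto
    have "card ?J = card (?B - F k)"
      using card_F[of k] by (simp add: card_Diff_subset fin F)
    then obtain h2 where h2: "bij_betw h2 ?J (?B - F k)"
      using finite_same_card_bij[of ?J "?B - F k"] by auto
    define p where "p n = (if n \<in> ?I then h1 n else h2 n)" for n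
    have "bij_betw p ?I (F k)"
      using h1 by (rule iffD1[OF bij_betw_cong, rotated]) (simp add: p_def)
    moreover have "bij_betw p ?J (?B - F k)"
      using h2 by (rule iffD1[OF bij_betw_cong, rotated]) (simp add: p_def)
    ultimately have "bij_betw p (?I \<union> ?J) (F k \<union> (?B - F k))"
      by (rule bij_betw_combine) auto
    moreover have "?I \<union> ?J = ?B" "F k \<union> (?B - F k) = ?B"
      using card_F[of k] F[of k] by auto
    moreover have "p ` ?I = F k"
      using \<open>bij_betw p ?I (F k)\<close> by (simp add: bij_betw_def)
    ultimately show ?thesis by auto
  qed
  then obtain p where p: "\<And>k. bij_betw (p k) {N k..<N (Suc k)} {N k..<N (Suc k)}"
    and p_F: "\<And>k. p k ` {N k..<N k + card (F k)} = F k"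
    by metis
  obtain \<pi> where "bij \<pi>" and \<pi>: "\<And>k n. n \<in> {N k..<N (Suc k)} \<Longrightarrow> \<pi> n = p k n"
    using bij_betw_glue_blocks[OF \<open>strict_mono N\<close> N_0 p] by blast
  have "summable (\<lambda>n. a (\<pi> n))"
    using assms \<open>bij \<pi>\<close> by blast
  then have "Cauchy (\<lambda>n. \<Sum>i<n. a (\<pi> i))"
    by (simp add: summable_iff_convergent convergent_Cauchy)
  then obtain K where K: "\<And>m n. m \<ge> K \<Longrightarrow> n \<ge> K \<Longrightarrow>
      norm ((\<Sum>i<m. a (\<pi> i)) - (\<Sum>i<n. a (\<pi> i))) < e"
    using \<open>e > 0\<close> unfolding Cauchy_def dist_norm by metis
  have "K \<le> N K"
    using \<open>strict_mono N\<close> by (rule strict_mono_imp_increasing)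
  have "\<pi> ` {N K..<N K + card (F K)} = F K"
    using p_F[of K] \<pi>[of _ K] card_F[of K] by (auto simp: image_iff)
  then have "(\<Sum>n\<in>F K. a n) = (\<Sum>i\<in>{N K..<N K + card (F K)}. a (\<pi> i))"
    using bij_is_inj[OF \<open>bij \<pi>\<close>] by (metis (no_types) inj_on_subset sum.reindex_cong subset_UNIV)
  also have "\<dots> = (\<Sum>i<N K + card (F K). a (\<pi> i)) - (\<Sum>i<N K. a (\<pi> i))"
    by (simp add: sum_diff[symmetric] lessThan_minus_lessThan)
  finally show False
    using K[of "N K + card (F K)" "N K"] \<open>K \<le> N K\<close> G(3)[of "N K"] by (simp add: F_def)
qed

lemma unconditionally_Cauchy_rearrangement_summable:
  fixes a :: "nat \<Rightarrow> 'a::banach"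
  assumes "unconditionally_Cauchy a" "bij \<pi>"
  shows "summable (\<lambda>n. a (\<pi> n))"
  unfolding summable_Cauchy
proof (intro allI impI)
  fix e :: real assume "e > 0"
  then obtain N where N: "\<And>F. finite F \<Longrightarrow> F \<subseteq> {N..} \<Longrightarrow> norm (\<Sum>n\<in>F. a n) < e"
    using assms(1) unfolding unconditionally_Cauchy_def by meson
  have inj: "inj \<pi>"
    using \<open>bij \<pi>\<close> by (rule bij_is_inj)
  have "finite (\<pi> -` {..<N})"
    using inj by (simp add: finite_vimageI)
  then obtain K where K: "\<And>n. n \<in> \<pi> -` {..<N} \<Longrightarrow> n < K"
    unfolding finite_nat_set_iff_bounded by blast
  have "norm (\<Sum>i\<in>{m..<n}. a (\<pi> i)) < e" if "m \<ge> K" for m n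
  proof -
    have "\<pi> ` {m..<n} \<subseteq> {N..}"
      using K that by (force simp: not_less[symmetric])
    moreover have "(\<Sum>i\<in>{m..<n}. a (\<pi> i)) = (\<Sum>i\<in>\<pi> ` {m..<n}. a i)"
      using inj by (simp add: sum.reindex inj_on_subset)
    ultimately show ?thesis
      using N[of "\<pi> ` {m..<n}"] by simp
  qed
  then show "\<exists>N. \<forall>m\<ge>N. \<forall>n. norm (\<Sum>i\<in>{m..<n}. a (\<pi> i)) < e"
    by blast
qed

lemma unconditionally_sums_iff_Cauchy:
  fixes a :: "nat \<Rightarrow> 'a::banach"
  shows "unconditionally_sums a s \<longleftrightarrow> a sums s \<and> unconditionally_Cauchy a"
  unfolding unconditionally_sums_def
  using unconditionally_Cauchy_if_rearrangements_summable
    unconditionally_Cauchy_rearrangement_summable by blast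

lemma unconditionally_Cauchy_bounded_finite_sums:
  assumes "unconditionally_Cauchy a"
  shows "\<exists>M. \<forall>F. finite F \<longrightarrow> norm (\<Sum>n\<in>F. a n) \<le> M"
proof -
  obtain N where N: "\<And>F. finite F \<Longrightarrow> F \<subseteq> {N..} \<Longrightarrow> norm (\<Sum>n\<in>F. a n) < 1"
    using assms unfolding unconditionally_Cauchy_def by (meson zero_less_one)
  have "norm (\<Sum>n\<in>F. a n) \<le> (\<Sum>n<N. norm (a n)) + 1" if "finite F" for F
  proof -
    have "(\<Sum>n\<in>F. a n) = (\<Sum>n\<in>F \<inter> {..<N}. a n) + (\<Sum>n\<in>F - {..<N}. a n)"
      using that by (rule sum.Int_Diff)
    moreover have "norm (\<Sum>n\<in>F \<inter> {..<N}. a n) \<le> (\<Sum>n<N. norm (a n))"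
      by (rule order_trans[OF norm_sum sum_mono2]) auto
    moreover have "norm (\<Sum>n\<in>F - {..<N}. a n) < 1"
      using that by (intro N) auto
    ultimately show ?thesis
      by (smt (verit) norm_triangle_ineq)
  qed
  then show ?thesis by blast
qed

section \<open>Two consequences of the Baire category theorem\<close>

lemma Baire_closed_cover_interior:
  fixes E :: "nat \<Rightarrow> 'b::topological_space set"
  assumes "completely_metrizable_space (euclidean :: 'b topology) \<or>
      locally_compact_space (euclidean :: 'b topology) \<and> regular_space (euclidean :: 'b topology)"
    and "\<And>n. closed (E n)" and cover: "(\<Union>n. E n) = UNIV"
  obtains n U where "open U" "U \<noteq> {}" "U \<subseteq> E n"
proof -
  have "\<exists>n. interior (E n) \<noteq> {}"
  proof (rule ccontr)
    assume "\<not> ?thesis"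
    then have "euclidean interior_of \<Union>(range E) = {}"
      using assms by (intro Baire_category_alt) auto
    then show False
      by (simp add: cover)
  qed
  then show ?thesis
    using that[OF open_interior _ interior_subset] by blast
qed

text \<open>By Baire, all operators are bounded by one constant on some ball; linearity moves this ball to
  the origin. The family is indexed by a set rather than a type because the application is to the
  finite sets of indices.\<close>

lemma uniform_boundedness:
  fixes T :: "'i \<Rightarrow> 'a::banach \<Rightarrow> 'b::real_normed_vector"
  assumes T: "\<And>i. i \<in> I \<Longrightarrow> bounded_linear (T i)"
    and bdd: "\<And>v. \<exists>M. \<forall>i\<in>I. norm (T i v) \<le> M"
  obtains M where "0 < M" "\<And>i v. i \<in> I \<Longrightarrow> norm (T i v) \<le> M * norm v"
proof -
  define E where "E n = (\<Inter>i\<in>I. {v. norm (T i v) \<le> real n})" for n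
  have "closed (E n)" for n
    unfolding E_def
  proof (intro closed_INT ballI closed_Collect_le continuous_on_norm continuous_on_const)
    show "continuous_on UNIV (T i)" if "i \<in> I" for i
      using T[OF that] by (simp add: linear_continuous_on)
  qed
  moreover have "(\<Union>n. E n) = UNIV"
  proof -
    have "\<exists>n. v \<in> E n" for v
    proof -
      obtain M where "\<forall>i\<in>I. norm (T i v) \<le> M" using bdd by blast
      then show ?thesis
        by (intro exI[of _ "nat \<lceil>M\<rceil>"]) (auto simp: E_def intro: order_trans real_nat_ceiling_ge)
    qed
    then show ?thesis by blast
  qed
  ultimately obtain n U where U: "open U" "U \<noteq> {}" "U \<subseteq> E n"
    by (rule Baire_closed_cover_interior[OF disjI1[OF completely_metrizable_space_euclidean]])
  then obtain u r where "r > 0" and ball: "cball u r \<subseteq> E n"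
    by (meson ex_in_conv open_contains_cball subset_trans)
  have ball: "norm (T i w) \<le> n" if "i \<in> I" "norm (w - u) \<le> r" for i w
    using ball that by (auto simp: E_def dist_norm norm_minus_commute)
  have bound: "norm (T i v) \<le> (2 * n / r) * norm v" if i: "i \<in> I" for i v
  proof (cases "v = 0")
    case True
    then show ?thesis
      using linear_simps(3)[OF T[OF i]] by simp
  next
    case False
    define t where "t = r / norm v"
    have "t > 0"
      using False \<open>r > 0\<close> by (simp add: t_def)
    have "t *\<^sub>R T i v = T i (u + t *\<^sub>R v) - T i u"
      by (simp add: linear_simps[OF T[OF i]])
    then have "t * norm (T i v) = norm (T i (u + t *\<^sub>R v) - T i u)"
      using \<open>t > 0\<close> by (metis abs_of_pos norm_scaleR)
    also have "\<dots> \<le> real n + real n"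
    proof (rule order_trans[OF norm_triangle_ineq4 add_mono])
      show "norm (T i (u + t *\<^sub>R v)) \<le> n" "norm (T i u) \<le> n"
        using False \<open>r > 0\<close> by (auto intro!: ball[OF i] simp: t_def)
    qed
    finally show ?thesis
      using False \<open>r > 0\<close> by (simp add: t_def field_simps)
  qed
  show ?thesis
  proof
    \<comment> \<open>The summand 1 makes the constant positive when \<open>n = 0\<close>.\<close>
    show "0 < 2 * n / r + 1"
      using \<open>r > 0\<close> by (simp add: add_nonneg_pos)
    show "norm (T i v) \<le> (2 * n / r + 1) * norm v" if "i \<in> I" for i v
      using bound[OF that, of v] by (simp add: distrib_right add_increasing2)
  qed
qed

text \<open>A quantitative form of the theorem that functions of the first Baire class have points of
  continuity. On a nonempty open set some \<open>F n\<close> approximates \<open>z\<close> uniformly, and near a point of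
  this set the continuous function \<open>F n\<close> is almost constant.\<close>

lemma pointwise_limit_small_oscillation:
  fixes F :: "nat \<Rightarrow> 'b::topological_space \<Rightarrow> 'a::metric_space"
  assumes Baire: "completely_metrizable_space (euclidean :: 'b topology) \<or>
      locally_compact_space (euclidean :: 'b topology) \<and> regular_space (euclidean :: 'b topology)"
    and cont: "\<And>n. continuous_on UNIV (F n)"
    and lim: "\<And>A. (\<lambda>n. F n A) \<longlonglongrightarrow> z A"
    and "e > 0"
  obtains U where "open U" "U \<noteq> {}" "\<And>A B. A \<in> U \<Longrightarrow> B \<in> U \<Longrightarrow> dist (z A) (z B) < e"
proof -
  \<comment> \<open>Two points of the open set are compared along a chain of four links, each at most \<open>d\<close> long.\<close>
  define d where "d = e / 5"
  have "d > 0" using \<open>e > 0\<close> by (simp add: d_def)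
  define E where "E n = (\<Inter>m\<in>{n..}. {A. dist (F n A) (F m A) \<le> d})" for n
  have "closed (E n)" for n
    unfolding E_def
    by (intro closed_INT ballI closed_Collect_le continuous_on_dist cont continuous_on_const)
  moreover have "(\<Union>n. E n) = UNIV"
  proof -
    have "\<exists>n. A \<in> E n" for A
    proof -
      have "Cauchy (\<lambda>n. F n A)"
        using lim LIMSEQ_imp_Cauchy by blast
      then obtain n where "\<forall>m\<ge>n. \<forall>k\<ge>n. dist (F m A) (F k A) < d"
        using \<open>d > 0\<close> unfolding Cauchy_def by blast
      then have "A \<in> E n"
        by (auto simp: E_def intro: less_imp_le)
      then show ?thesis ..
    qed
    then show ?thesis by blast
  qed
  ultimately obtain n V where V: "open V" "V \<noteq> {}" "V \<subseteq> E n"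
    by (rule Baire_closed_cover_interior[OF Baire])
  obtain A0 where "A0 \<in> V" using V by blast
  define U where "U = V \<inter> F n -` ball (F n A0) d"
  have "open U"
    unfolding U_def using V(1) cont[of n] by (intro open_Int open_vimage) auto
  moreover have "A0 \<in> U"
    using \<open>A0 \<in> V\<close> \<open>d > 0\<close> by (simp add: U_def)
  moreover have "dist (z A) (z B) < e" if "A \<in> U" "B \<in> U" for A B
  proof -
    have near: "dist (F n C) (z C) \<le> d" if "C \<in> U" for C
    proof (rule Lim_dist_ubound[OF _ lim])
      show "\<forall>\<^sub>F m in sequentially. dist (F n C) (F m C) \<le> d"
        using that V(3) by (auto simp: U_def E_def eventually_sequentially)
    qed simp
    have "dist (F n A0) (F n A) < d" "dist (F n A0) (F n B) < d"
      using that by (auto simp: U_def)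
    moreover have "dist (z A) (z B) \<le>
        dist (F n A) (z A) + dist (F n A0) (F n A) + dist (F n A0) (F n B) + dist (F n B) (z B)"
      by metric
    ultimately show ?thesis
      using near[OF that(1)] near[OF that(2)] \<open>d > 0\<close> unfolding d_def by linarith
  qed
  ultimately show ?thesis
    using that by blast
qed

section \<open>Subseries parametrised by the Cantor space\<close>

lemma Cantor_space_Baire:
  "locally_compact_space (euclidean :: (nat \<Rightarrow> bool) topology) \<and>
   regular_space (euclidean :: (nat \<Rightarrow> bool) topology)"
proof -
  have "compact_space (euclidean :: bool topology)"
    using finite_imp_compact[of "UNIV :: bool set"] by (simp add: compact_space_def)
  then have "compact_space (euclidean :: (nat \<Rightarrow> bool) topology)"
    unfolding euclidean_product_topology[symmetric]
    by (simp add: compact_space_product_topology)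
  moreover have "Hausdorff_space (euclidean :: bool topology)"
    unfolding Hausdorff_space_def disjnt_def by (metis hausdorff open_openin)
  then have "Hausdorff_space (euclidean :: (nat \<Rightarrow> bool) topology)"
    unfolding euclidean_product_topology[symmetric]
    by (simp add: Hausdorff_space_product_topology)
  ultimately show ?thesis
    by (simp add: compact_imp_locally_compact_space compact_Hausdorff_imp_regular_space)
qed

text \<open>A point of the Cantor space is the indicator of a set of indices; a cylinder around it consists
  of the sets that agree with it below some index.\<close>

lemma open_Cantor_contains_cylinder:
  fixes U :: "(nat \<Rightarrow> bool) set"
  assumes "open U" "A \<in> U"
  obtains K where "\<And>B. (\<And>n. n < K \<Longrightarrow> B n = A n) \<Longrightarrow> B \<in> U"
proof -
  obtain X where X: "A \<in> (\<Pi>\<^sub>E i\<in>UNIV. X i)" "finite {i. X i \<noteq> UNIV}" "(\<Pi>\<^sub>E i\<in>UNIV. X i) \<subseteq> U"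
    using product_topology_open_contains_basis[of "\<lambda>_. euclidean" UNIV U A] assms
    by (auto simp: open_fun_def)
  obtain K where K: "\<And>i. X i \<noteq> UNIV \<Longrightarrow> i < K"
    using X(2) unfolding finite_nat_set_iff_bounded by blast
  show ?thesis
  proof
    fix B assume B: "\<And>n. n < K \<Longrightarrow> B n = A n"
    have "B i \<in> X i" for i
      using B[of i] K[of i] X(1) by (cases "X i = UNIV") (auto simp: PiE_iff)
    then show "B \<in> U"
      using X(3) by (auto simp: PiE_iff)
  qed
qed

text \<open>The partial sums depend on finitely many coordinates and converge uniformly over all subseries.\<close>

lemma continuous_subseries_sum:
  fixes c :: "nat \<Rightarrow> 'b::banach"
  assumes "summable (\<lambda>n. norm (c n))"
  shows "continuous_on UNIV (\<lambda>A :: nat \<Rightarrow> bool. \<Sum>n. if A n then c n else 0)"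
proof (rule uniform_limit_theorem)
  show "uniform_limit UNIV (\<lambda>N A. \<Sum>n<N. if A n then c n else 0)
      (\<lambda>A :: nat \<Rightarrow> bool. \<Sum>n. if A n then c n else 0) sequentially"
    using assms by (intro Weierstrass_m_test[where M = "\<lambda>n. norm (c n)"]) auto
  have "continuous_on UNIV (\<lambda>A :: nat \<Rightarrow> bool. if A n then c n else 0)" for n
    by (rule continuous_on_compose2[of UNIV "\<lambda>b. if b then c n else 0" UNIV "\<lambda>A. A n"]) auto
  then show "\<forall>\<^sub>F N in sequentially.
      continuous_on UNIV (\<lambda>A :: nat \<Rightarrow> bool. \<Sum>n<N. if A n then c n else 0)"
    by (intro always_eventually allI continuous_on_sum)
qed simp

section \<open>Schauder frames\<close>

context banach_space_over
begin

lemma bounded_linear_scale_left: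
  assumes "g \<in> topological_dual scaleK"
  shows "bounded_linear (\<lambda>v. scaleK (blinfun_apply g v) y)"
proof (rule bounded_linear_intro[where K = "norm g * norm y"])
  show "scaleK (g (r *\<^sub>R v)) y = r *\<^sub>R scaleK (g v) y" for r v
    using scale_of_real[of r "scaleK (g v) y"]
    by (simp add: blinfun.scaleR_right scaleR_conv_of_real)
  show "norm (scaleK (g v) y) \<le> norm v * (norm g * norm y)" for v
    using mult_right_mono[OF norm_blinfun[of g v] norm_ge_zero[of y]]
    by (simp add: norm_scale mult_ac)
qed (simp add: blinfun.add_right scale_left_distrib)

lemma unconditional_schauder_frame_imp_besselian:
  assumes f: "\<And>n. f n \<in> topological_dual scaleK"
    and frame: "unconditional_schauder_frame scaleK x f"
  shows "besselian scaleK x f"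
proof -
  define T where "T A v = (\<Sum>n\<in>A. scaleK (f n v) (x n))" for A v
  have "bounded_linear (T A)" for A
    unfolding T_def by (intro bounded_linear_sum bounded_linear_scale_left f)
  moreover have "\<exists>M. \<forall>A\<in>Collect finite. norm (T A v) \<le> M" for v
    using frame unconditionally_Cauchy_bounded_finite_sums[of "\<lambda>n. scaleK (f n v) (x n)"]
    unfolding unconditional_schauder_frame_def unconditionally_sums_iff_Cauchy T_def by blast
  ultimately obtain M where "0 < M"
    and M: "\<And>A v. finite A \<Longrightarrow> norm (T A v) \<le> M * norm v"
    using uniform_boundedness[of "Collect finite" T] unfolding mem_Collect_eq by blast
  have bound: "(\<Sum>n<N. norm (f n v) * norm (g (x n))) \<le> 4 * M * norm v * norm g"
    if g: "g \<in> topological_dual scaleK" for v g N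
  proof -
    have "norm (\<Sum>n\<in>A. f n v * g (x n)) \<le> norm g * (M * norm v)" if "A \<subseteq> {..<N}" for A
    proof -
      have "(\<Sum>n\<in>A. f n v * g (x n)) = g (T A v)"
        using g by (simp add: T_def blinfun.sum_right topological_dual_def)
      also have "norm \<dots> \<le> norm g * norm (T A v)"
        by (rule norm_blinfun)
      also have "\<dots> \<le> norm g * (M * norm v)"
        using that finite_subset by (intro mult_left_mono M) auto
      finally show ?thesis .
    qed
    then have "(\<Sum>n<N. norm (f n v * g (x n))) \<le> 4 * (norm g * (M * norm v))"
      by (intro sum_norm_le_4_subset_sums) auto
    then show ?thesis
      by (simp add: norm_mult mult_ac)
  qed
  show ?thesis
    unfolding besselian_def
  proof (intro exI[of _ "4 * M"] conjI allI ballI)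
    fix v g assume g: "g \<in> topological_dual scaleK"
    show "summable (\<lambda>n. norm (f n v) * norm (g (x n)))"
      by (rule summableI_nonneg_bounded[OF _ bound[OF g]]) simp
    then show "(\<Sum>n. norm (f n v) * norm (g (x n))) \<le> 4 * M * norm v * norm g"
      using bound[OF g] by (rule suminf_le_const)
  qed (use \<open>0 < M\<close> in simp)
qed

lemma weakly_sequentially_complete_subseries_sum:
  assumes wsc: "weakly_sequentially_complete scaleK"
    and abs: "\<And>g. g \<in> topological_dual scaleK \<Longrightarrow> summable (\<lambda>n. norm (blinfun_apply g (a n)))"
  shows "\<exists>z. \<forall>g \<in> topological_dual scaleK. (\<lambda>n. if A n then g (a n) else 0) sums g z"
proof -
  define y where "y N = (\<Sum>n<N. if A n then a n else 0)" for N
  have g_y: "g (y N) = (\<Sum>n<N. if A n then g (a n) else 0)" for g :: "'a \<Rightarrow>\<^sub>L 'k" and N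
    unfolding y_def blinfun.sum_right by (intro sum.cong) auto
  have "convergent (\<lambda>N. g (y N))" if "g \<in> topological_dual scaleK" for g
  proof -
    have "summable (\<lambda>n. if A n then g (a n) else 0)"
      by (rule summable_comparison_test'[OF abs[OF that]]) simp
    then show ?thesis
      by (simp add: g_y summable_iff_convergent)
  qed
  then show ?thesis
    using wsc unfolding weakly_sequentially_complete_def sums_def g_y[symmetric] by blast
qed

text \<open>A weakly unconditionally Cauchy series is unconditionally Cauchy in norm. In general this
  combines weak sequential completeness with the Orlicz-Pettis theorem; the frame allows the direct
  Baire category argument on the Cantor space of subseries.\<close>

lemma weakly_unconditionally_Cauchy_imp_unconditionally_Cauchy:
  assumes wsc: "weakly_sequentially_complete scaleK"
    and f: "\<And>n. f n \<in> topological_dual scaleK"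
    and frame: "schauder_frame scaleK x f"
    and abs: "\<And>g. g \<in> topological_dual scaleK \<Longrightarrow> summable (\<lambda>n. norm (blinfun_apply g (a n)))"
  shows "unconditionally_Cauchy a"
  unfolding unconditionally_Cauchy_def
proof (intro allI impI)
  fix e :: real assume "e > 0"
  obtain z where z: "\<And>A g. g \<in> topological_dual scaleK \<Longrightarrow>
      (\<lambda>n. if A n then g (a n) else 0) sums g (z A)"
    using weakly_sequentially_complete_subseries_sum[OF wsc abs] by metis
  define P where "P N A = (\<Sum>m<N. scaleK (f m (z A)) (x m))" for N A
  have f_z: "f m (z A) = (\<Sum>n. if A n then f m (a n) else 0)" for m A
    using z[OF f] by (rule sums_unique)
  have "continuous_on UNIV (P N)" for N
    unfolding P_def
  proof (rule continuous_on_sum)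
    fix m
    have "bounded_linear (\<lambda>c. scaleK c (x m))"
    proof (rule bounded_linear_intro)
      show "scaleK (r *\<^sub>R c) (x m) = r *\<^sub>R scaleK c (x m)" for r c
        using scale_of_real[of r "scaleK c (x m)"] by (simp add: scaleR_conv_of_real)
    qed (auto simp: scale_left_distrib norm_scale)
    then show "continuous_on UNIV (\<lambda>A. scaleK (f m (z A)) (x m))"
      unfolding f_z by (rule bounded_linear.continuous_on) (intro continuous_subseries_sum abs f)
  qed
  moreover have "(\<lambda>N. P N A) \<longlonglongrightarrow> z A" for A
    using frame unfolding schauder_frame_def sums_def P_def by blast
  ultimately obtain U where U: "open U" "U \<noteq> {}"
    and osc: "\<And>A B. A \<in> U \<Longrightarrow> B \<in> U \<Longrightarrow> dist (z A) (z B) < e"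
    using pointwise_limit_small_oscillation[of P z e] Cantor_space_Baire \<open>e > 0\<close> by blast
  obtain A where "A \<in> U" using U by blast
  then obtain K where K: "\<And>B. (\<And>n. n < K \<Longrightarrow> B n = A n) \<Longrightarrow> B \<in> U"
    using open_Cantor_contains_cylinder[OF U(1)] by blast
  have "norm (\<Sum>n\<in>F. a n) < e" if "finite F" "F \<subseteq> {K..}" for F
  proof -
    \<comment> \<open>Both sets agree with \<open>A\<close> below \<open>K\<close>, and they differ by exactly \<open>F\<close>.\<close>
    define B where "B n \<longleftrightarrow> A n \<or> n \<in> F" for n
    define C where "C n \<longleftrightarrow> A n \<and> n \<notin> F" for n
    have "f m (z B - z C) = f m (\<Sum>n\<in>F. a n)" for m
    proof (rule sums_unique2)
      have "(\<lambda>n. (if B n then f m (a n) else 0) - (if C n then f m (a n) else 0))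
          sums (f m (z B) - f m (z C))"
        by (intro sums_diff z f)
      moreover have "(\<lambda>n. (if B n then f m (a n) else 0) - (if C n then f m (a n) else 0))
          = (\<lambda>n. if n \<in> F then f m (a n) else 0)"
        by (auto simp: B_def C_def)
      ultimately show "(\<lambda>n. if n \<in> F then f m (a n) else 0) sums f m (z B - z C)"
        by (simp add: blinfun.diff_right)
      show "(\<lambda>n. if n \<in> F then f m (a n) else 0) sums f m (\<Sum>n\<in>F. a n)"
        unfolding blinfun.sum_right using \<open>finite F\<close> by (rule sums_If_finite_set)
    qed
    \<comment> \<open>Equal coefficients mean equal frame expansions, hence equal vectors.\<close>
    then have "(\<lambda>m. scaleK (f m (z B - z C)) (x m)) = (\<lambda>m. scaleK (f m (\<Sum>n\<in>F. a n)) (x m))"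
      by simp
    then have "z B - z C = (\<Sum>n\<in>F. a n)"
      using frame[unfolded schauder_frame_def, rule_format, of "z B - z C"]
        frame[unfolded schauder_frame_def, rule_format, of "\<Sum>n\<in>F. a n"]
      by (simp only: sums_unique2)
    moreover have "B \<in> U" "C \<in> U"
      using that(2) by (auto intro!: K simp: B_def C_def)
    ultimately show ?thesis
      using osc[of B C] by (simp add: dist_norm)
  qed
  then show "\<exists>N. \<forall>F. finite F \<longrightarrow> F \<subseteq> {N..} \<longrightarrow> norm (\<Sum>n\<in>F. a n) < e"
    by blast
qed

lemma besselian_schauder_frame_imp_unconditional:
  assumes "weakly_sequentially_complete scaleK"
    and "\<And>n. f n \<in> topological_dual scaleK"
    and frame: "besselian_schauder_frame scaleK x f"
  shows "unconditional_schauder_frame scaleK x f"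
proof -
  have sf: "schauder_frame scaleK x f" and bess: "besselian scaleK x f"
    using frame by (auto simp: besselian_schauder_frame_def)
  have "summable (\<lambda>n. norm (g (scaleK (f n v) (x n))))" if "g \<in> topological_dual scaleK" for g v
    using bess that by (auto simp: besselian_def topological_dual_def norm_mult)
  then have "unconditionally_Cauchy (\<lambda>n. scaleK (f n v) (x n))" for v
    by (rule weakly_unconditionally_Cauchy_imp_unconditionally_Cauchy[OF assms(1,2) sf])
  then show ?thesis
    using sf unfolding unconditional_schauder_frame_def schauder_frame_def
      unconditionally_sums_iff_Cauchy by blast
qed

end

theorem corollary5:
  fixes scaleK :: "'k::real_or_complex \<Rightarrow> 'a::banach \<Rightarrow> 'a"
    and x :: "nat \<Rightarrow> 'a"
    and f :: "nat \<Rightarrow> 'a \<Rightarrow>\<^sub>L 'k"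
  assumes "banach_space_over scaleK"
    and "weakly_sequentially_complete scaleK"
    and "\<And>n. f n \<in> topological_dual scaleK"
  shows "unconditional_schauder_frame scaleK x f \<longleftrightarrow> besselian_schauder_frame scaleK x f"
proof -
  interpret banach_space_over scaleK by fact
  show ?thesis
  proof
    assume frame: "unconditional_schauder_frame scaleK x f"
    then have "schauder_frame scaleK x f"
      by (simp add: unconditional_schauder_frame_def schauder_frame_def unconditionally_sums_def)
    with frame show "besselian_schauder_frame scaleK x f"
      using unconditional_schauder_frame_imp_besselian assms(3)
      by (simp add: besselian_schauder_frame_def)
  next
    assume "besselian_schauder_frame scaleK x f"
    then show "unconditional_schauder_frame scaleK x f"
      using besselian_schauder_frame_imp_unconditional assms(2,3) by blast
  qed
qed

end
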